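(* Let $k,r$ be positive integers, $m_1,\dots,m_k\in\mathbb{N}$, $k_r\in\mathbb{N}$, $k_1,\dots,k_{r-1}\in\mathbb{N}_0$. Then \begin{align*} \zeta\left((k_r+1,\dots,k_1+1)\circledast(0,m_1+1,\dots,m_k+1)^\star\right)&=(-1)^k\sum_{j=1}^{k+1}\zeta\left(\mathbf{k}_r^v,\mathbf{m}_{j-1}^v\right)\sum_{l=1}^{k+1-j}(-1)^l\\ &\qquad\times\sum_{\substack{i_0<i_1<\cdots<i_l\\ i_0=j,\ i_l=k+1}}\prod_{h=1}^l\zeta\left(m_{i_h-1}+1,\dots,m_{i_{h-1}+1}+1,m_{i_{h-1}}+1\right), \end{align*} where the inner expression $\sum_{l=1}^{0}(\cdots)$ (the case $j=k+1$) is interpreted as $1$, $\mathbf{k}_r^v=\big(2\Box\{1\}_{k_1-1}\Box2\Box\cdots\Box2\Box\{1\}_{k_{r-1}-1}\Box2,\{1\}_{k_r-1}\big)$, $\mathbf m_{q}^v=(2,\{1\}_{m_1-1},2,\{1\}_{m_2-1},\dots,2,\{1\}_{m_q-1})$ for $q\ge1$, and $\mathbf m_0^v=\emptyset$.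
   Context: Multiple zeta values $\zeta(s_1,\dots,s_r)=\sum_{n_1>\cdots>n_r\ge1}n_1^{-s_1}\cdots n_r^{-s_r}$ ($s_1\ge2$); $\zeta_n(s_1,\dots,s_r)=\sum_{n\ge n_1>\cdots>n_r\ge1}\prod n_j^{-s_j}$, $\zeta^\star_n(s_1,\dots,s_r)=\sum_{n\ge n_1\ge\cdots\ge n_r\ge1}\prod n_j^{-s_j}$ (both $1$ for empty index). $\{1\}_d$: $d$ entries $1$ (empty if $d=0$). Box convention: $u\,\Box\,\{1\}_{q-1}\,\Box\,v$ is $u,\{1\}_{q-1},v$ if $q\ge1$ and the single entry $u+v-1$ if $q=0$ (repeatedly for consecutive zeros). Kaneko–Yamamoto value: $\zeta\left((k_r+1,\dots,k_1+1)\circledast(0,l_1,\dots,l_s)^\star\right)=\sum_{n\ge1}\frac{\zeta_{n-1}(k_{r-1}+1,\dots,k_1+1)\zeta^\star_n(l_1,\dots,l_s)}{n^{k_r+1}}$. *)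

theory Defs
  imports "HOL-Analysis.Analysis"
begin

definition strict_chains :: "nat \<Rightarrow> nat list set" where
  "strict_chains r = {ns. length ns = r \<and> sorted_wrt (>) ns \<and> (\<forall>n\<in>set ns. 1 \<le> n)}"

definition weak_chains :: "nat \<Rightarrow> nat list set" where
  "weak_chains r = {ns. length ns = r \<and> sorted_wrt (\<ge>) ns \<and> (\<forall>n\<in>set ns. 1 \<le> n)}"

definition chain_term :: "nat list \<Rightarrow> nat list \<Rightarrow> real" where
  "chain_term s ns = (\<Prod>j<length s. 1 / real (ns ! j) ^ (s ! j))"

definition mzv :: "nat list \<Rightarrow> real" where
  "mzv s = (\<Sum>\<^sub>\<infinity>ns\<in>strict_chains (length s). chain_term s ns)"

definition mzv_upto :: "nat \<Rightarrow> nat list \<Rightarrow> real" where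
  "mzv_upto n s =
     (\<Sum>ns\<in>{ns\<in>strict_chains (length s). \<forall>i\<in>set ns. i \<le> n}. chain_term s ns)"

definition mzsv_upto :: "nat \<Rightarrow> nat list \<Rightarrow> real" where
  "mzsv_upto n s =
     (\<Sum>ns\<in>{ns\<in>weak_chains (length s). \<forall>i\<in>set ns. i \<le> n}. chain_term s ns)"

text \<open>
  The Kaneko--Yamamoto value of two nonempty indices. The outermost summation variable is shared by
  both indices, so its exponent is the sum of their first entries.
\<close>

definition kaneko_yamamoto :: "nat list \<Rightarrow> nat list \<Rightarrow> real" where
  "kaneko_yamamoto ks ls =
     (\<Sum>\<^sub>\<infinity>n\<in>{1..}. mzv_upto (n - 1) (tl ks) * mzsv_upto n (tl ls) / real n ^ (hd ks + hd ls))"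

text \<open>
  \<open>box us q v\<close> joins an index \<open>us\<close> with last entry \<open>u\<close> to the entry \<open>v\<close> by \<open>u \<box> {1}\<^bsub>q-1\<^esub> \<box> v\<close>.
  For \<open>q = 0\<close> the entries \<open>u\<close> and \<open>v\<close> merge into \<open>u + v - 1\<close>, which becomes the new last entry,
  so that iterating \<open>box\<close> handles consecutive zeros.
\<close>

definition box :: "nat list \<Rightarrow> nat \<Rightarrow> nat \<Rightarrow> nat list" where
  "box us q v = (if q \<ge> 1 then us @ replicate (q - 1) 1 @ [v]
                 else butlast us @ [last us + v - 1])"

definition k_dual :: "(nat \<Rightarrow> nat) \<Rightarrow> nat \<Rightarrow> nat list" where
  "k_dual \<kappa> r = foldl (\<lambda>us i. box us (\<kappa> i) 2) [2] [1..<r] @ replicate (\<kappa> r - 1) 1"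

definition m_dual :: "(nat \<Rightarrow> nat) \<Rightarrow> nat \<Rightarrow> nat list" where
  "m_dual m q = concat (map (\<lambda>i. 2 # replicate (m i - 1) 1) [1..<q + 1])"

end

theory Submission
  imports Defs
begin

text \<open>
  The claim splits into a stuffle identity and the duality of multiple zeta values.

  Let \<open>T\<^sub>j(n)\<close> be the sum of \<open>\<Prod> p\<^sub>i\<^bsup>-(m\<^sub>i+1)\<^esup>\<close> over \<open>n < p\<^sub>1 < \<dots> < p\<^sub>j\<close>, and let \<open>S\<^sub>j\<close> be the infinite
  star sum of \<open>(m\<^sub>j\<^sub>+\<^sub>1 + 1, \<dots>, m\<^sub>k + 1)\<close>. Splitting off the part \<open>p > n\<close> of the outermost sum and
  inducting on the index gives \<open>\<zeta>\<^sup>\<star>\<^sub>n(m\<^sub>1 + 1, \<dots>, m\<^sub>k + 1) = \<Sum>\<^sub>j (-1)\<^sup>j T\<^sub>j(n) S\<^sub>j\<close>. At \<open>n = 0\<close> the left-hand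
  side vanishes, which yields a recursion for \<open>S\<^sub>j\<close> that is solved by the signed sum over paths.
  Summing over \<open>n\<close> instead turns \<open>T\<^sub>j(n)\<close> into \<open>\<zeta>(m\<^sub>j + 1, \<dots>, m\<^sub>1 + 1, k\<^sub>r + 1, \<dots>, k\<^sub>1 + 1)\<close>, which is dual
  to \<open>\<zeta>(k\<^sub>r\<^sup>v, m\<^sub>j\<^sup>v)\<close>.

  Duality is proved with the connected sums of Seki and Yamamoto: with respect to the pairing of
  functions on the naturals with kernel \<open>n! m! / (n + m)!\<close>, the operators \<open>f(n) \<mapsto> f(n) / n\<close> and
  \<open>f(n) \<mapsto> (1/n) \<Sum>\<^bsub>p<n\<^esub> f(p)\<close> are adjoint to each other.
\<close>

section \<open>Duality by connected sums\<close>

text \<open>\<open>lead s n\<close> is the part of \<open>\<zeta>(s)\<close> with largest summation variable \<open>n\<close>; the empty chain is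
  assigned to \<open>n = 0\<close>.\<close>

primrec lead :: "nat list \<Rightarrow> nat \<Rightarrow> real" where
  "lead [] n = (if n = 0 then 1 else 0)"
| "lead (a # s) n = (1 / real n) ^ a * (\<Sum>p<n. lead s p)"

lemma lead_nonneg: "0 \<le> lead s n"
  by (induction s arbitrary: n) (auto intro!: mult_nonneg_nonneg sum_nonneg)

text \<open>\<open>True\<close> and \<open>False\<close> stand for the letters \<open>x\<^sub>0 = dt/t\<close> and \<open>x\<^sub>1 = dt/(1 - t)\<close> of the iterated integral.
  Since \<open>1 / 0 = 0\<close>, every letter kills the value at \<open>0\<close>.\<close>

definition letter :: "bool \<Rightarrow> (nat \<Rightarrow> ennreal) \<Rightarrow> nat \<Rightarrow> ennreal" where
  "letter b f n = ennreal (1 / real n) * (if b then f n else (\<Sum>p<n. f p))"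

text \<open>The word of the iterated integral for zeta(s). Duality of indices becomes reversal of
  this word combined with exchanging the two letters.\<close>

definition word :: "nat list \<Rightarrow> bool list" where
  "word s = concat (map (\<lambda>a. replicate (a - 1) True @ [False]) s)"

lemma word_Nil [simp]: "word [] = []"
  by (simp add: word_def)

lemma word_append [simp]: "word (s @ t) = word s @ word t"
  by (simp add: word_def)

lemma word_Cons: "word (a # s) = replicate (a - 1) True @ False # word s"
  by (simp add: word_def)

lemma word_replicate_1 [simp]: "word (replicate n (Suc 0)) = replicate n False"
  by (induction n) (auto simp: word_Cons)

definition unit_mass :: "nat \<Rightarrow> ennreal" where
  "unit_mass n = (if n = 0 then 1 else 0)"

lemma letter_0 [simp]: "letter b f 0 = 0"
  by (simp add: letter_def)

lemma letter_True_funpow: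
  "(letter True ^^ d) f n = ennreal ((1 / real n) ^ d) * f n"
proof (induction d)
  case (Suc d)
  have "(letter True ^^ Suc d) f n = ennreal (1 / real n) * ennreal ((1 / real n) ^ d) * f n"
    by (simp add: letter_def Suc mult.assoc)
  also have "ennreal (1 / real n) * ennreal ((1 / real n) ^ d) = ennreal ((1 / real n) ^ Suc d)"
    by (subst ennreal_mult[symmetric]) auto
  finally show ?case .
qed simp

lemma foldr_letter_word:
  assumes "\<forall>a\<in>set s. 1 \<le> a"
  shows "foldr letter (word s) unit_mass n = ennreal (lead s n)"
  using assms
proof (induction s arbitrary: n)
  case Nil
  then show ?case by (simp add: unit_mass_def)
next
  case (Cons a s)
  have "foldr letter (word (a # s)) unit_mass n =
      ennreal ((1 / real n) ^ (a - 1)) * (ennreal (1 / real n) * (\<Sum>p<n. ennreal (lead s p)))"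
    using Cons by (simp add: word_Cons letter_True_funpow) (simp add: letter_def)
  also have "\<dots> = ennreal ((1 / real n) ^ (a - 1) * ((1 / real n) * (\<Sum>p<n. lead s p)))"
    by (simp add: sum_ennreal lead_nonneg ennreal_mult' sum_nonneg flip: ennreal_mult'')
  also have "(1 / real n) ^ (a - 1) * ((1 / real n) * (\<Sum>p<n. lead s p)) = lead (a # s) n"
    using Cons.prems by (cases a) auto
  finally show ?case .
qed

section \<open>The connector and its telescoping sum\<close>

definition connector :: "nat \<Rightarrow> nat \<Rightarrow> real" where
  "connector n m = fact n * fact m / fact (n + m)"

lemma connector_nonneg: "0 \<le> connector n m"
  by (simp add: connector_def)

lemma connector_commute: "connector n m = connector m n"
  by (simp add: connector_def add.commute)

lemma connector_0 [simp]: "connector n 0 = 1"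
  by (simp add: connector_def)

text \<open>The factorials give \<open>connector n m\<close> = (n+m+1)/(m+1) *
  \<open>connector n (Suc m)\<close>, so the difference leaves the factor n/(m+1). This makes the
  sum of 1/m times the connector telescope.\<close>

lemma connector_diff:
  assumes "1 \<le> n"
  shows "1 / real (Suc m) * connector n (Suc m) = 1 / real n * (connector n m - connector n (Suc m))"
proof -
  have "connector n (Suc m) = fact n * (real (Suc m) * fact m) / (real (Suc (n + m)) * fact (n + m))"
    by (simp add: connector_def algebra_simps)
  then have "connector n m = real (Suc (n + m)) / real (Suc m) * connector n (Suc m)"
    by (simp add: connector_def del: of_nat_Suc)
  moreover have "1 / real (Suc m) * c = 1 / real n * (real (Suc (n + m)) / real (Suc m) * c - c)" for c :: real
    using assms by (simp add: divide_simps) (simp add: algebra_simps)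
  ultimately show ?thesis by metis
qed

lemma connector_tendsto_0:
  assumes "1 \<le> n"
  shows "connector n \<longlonglongrightarrow> 0"
proof -
  \<comment> \<open>The connector decreases in n and equals 1/(m+1) at n = 1; at n = 0 it is
    constantly 1.\<close>
  have le: "connector n m \<le> 1 / real (Suc m)" for m
    using assms
  proof (induction n rule: dec_induct)
    case base
    then show ?case by (simp add: connector_def field_simps)
  next
    case (step n)
    have "connector (Suc n) m = connector n m * (real (Suc n) / real (Suc (n + m)))"
      by (simp add: connector_def field_simps)
    also have "\<dots> \<le> connector n m * 1"
      by (intro mult_left_mono connector_nonneg) auto
    finally show ?case using step by simp
  qed
  show ?thesis
    by (rule tendsto_sandwich[OF _ _ tendsto_const LIMSEQ_inverse_real_of_nat])
      (use le in \<open>auto simp: connector_nonneg inverse_eq_divide\<close>)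
qed

lemma connector_sums:
  assumes "1 \<le> n"
  shows "(\<lambda>m. if p < m then 1 / real m * connector n m else 0) sums (1 / real n * connector n p)"
proof -
  have "(\<lambda>i. connector n (i + p)) \<longlonglongrightarrow> 0"
    using connector_tendsto_0[OF assms] by (rule LIMSEQ_ignore_initial_segment)
  then have "(\<lambda>i. 1 / real n * (connector n (i + p) - connector n (Suc i + p))) sums
      (1 / real n * (connector n (0 + p) - 0))"
    by (intro sums_mult telescope_sums')
  moreover have "1 / real n * (connector n (i + p) - connector n (Suc i + p)) =
      (if p < i + Suc p then 1 / real (i + Suc p) * connector n (i + Suc p) else 0)" for i
    using connector_diff[OF assms, of "i + p"] by (simp del: of_nat_Suc)
  ultimately have "(\<lambda>i. if p < i + Suc p then 1 / real (i + Suc p) * connector n (i + Suc p) else 0) sums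
      (1 / real n * connector n p)"
    by simp
  then show ?thesis
    by (subst (asm) sums_iff_shift) simp
qed

lemma suminf_swap_ennreal:
  fixes f :: "nat \<Rightarrow> nat \<Rightarrow> ennreal"
  shows "(\<Sum>i. \<Sum>j. f i j) = (\<Sum>j. \<Sum>i. f i j)"
proof -
  have "(\<Sum>i. \<Sum>j. f i j) = (\<integral>\<^sup>+i. (\<Sum>j. f i j) \<partial>count_space UNIV)"
    by (simp add: nn_integral_count_space_nat)
  also have "\<dots> = (\<Sum>j. \<integral>\<^sup>+i. f i j \<partial>count_space UNIV)"
    by (rule nn_integral_suminf) simp
  finally show ?thesis by (simp add: nn_integral_count_space_nat)
qed

lemma sum_lessThan_eq_suminf_ennreal:
  fixes f :: "nat \<Rightarrow> ennreal"
  shows "(\<Sum>p<m. f p) = (\<Sum>p. if p < m then f p else 0)"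
  by (subst suminf_finite[of "{..<m}"]) auto

text \<open>Values in \<open>ennreal\<close> make all rearrangements unconditional; convergence of
  the zeta series enters only in \<open>ennreal_mzv\<close>.\<close>

definition pairing :: "(nat \<Rightarrow> ennreal) \<Rightarrow> (nat \<Rightarrow> ennreal) \<Rightarrow> ennreal" where
  "pairing f g = (\<Sum>n. \<Sum>m. f n * g m * ennreal (connector n m))"

lemma pairing_commute: "pairing f g = pairing g f"
  unfolding pairing_def
  by (subst suminf_swap_ennreal) (simp add: connector_commute mult.commute)

lemma pairing_unit_mass: "pairing f unit_mass = (\<Sum>n. f n)"
proof -
  have "(\<Sum>m. f n * unit_mass m * ennreal (connector n m)) = f n" for n
    by (subst suminf_finite[of "{0}"]) (auto simp: unit_mass_def)
  then show ?thesis by (simp add: pairing_def)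
qed

text \<open>After exchanging the sums over p and m, \<open>connector_sums\<close> trades the weight
  1/m summed over m > p for the factor 1/n. At n = 0 the connector is 1 and that sum is a divergent
  harmonic series, hence the assumption.\<close>

lemma pairing_letter_True:
  assumes "f 0 = 0"
  shows "pairing (letter True f) g = pairing f (letter False g)"
proof -
  have "(\<Sum>m. f n * letter False g m * ennreal (connector n m)) =
        (\<Sum>m. letter True f n * g m * ennreal (connector n m))" for n
  proof (cases "n = 0")
    case False
    have *: "ennreal (connector n m / real i) = ennreal (connector n m) * ennreal (1 / real i)" for i m
      by (subst ennreal_mult[symmetric]) (auto simp: connector_nonneg)
    have "(\<Sum>m. f n * letter False g m * ennreal (connector n m)) =
        (\<Sum>m. \<Sum>p. f n * g p * ennreal (if p < m then 1 / real m * connector n m else 0))"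
      by (intro suminf_cong)
        (auto simp: letter_def sum_lessThan_eq_suminf_ennreal * mult_ac
          intro!: suminf_cong simp flip: ennreal_suminf_cmult)
    also have "\<dots> = (\<Sum>p. \<Sum>m. f n * g p * ennreal (if p < m then 1 / real m * connector n m else 0))"
      by (rule suminf_swap_ennreal)
    also have "\<dots> = (\<Sum>p. f n * g p * ennreal (1 / real n * connector n p))"
    proof (intro suminf_cong)
      fix p
      have "(\<Sum>m. ennreal (if p < m then 1 / real m * connector n m else 0)) =
          ennreal (1 / real n * connector n p)"
        using connector_sums[of n p] False
        by (subst suminf_ennreal2) (auto simp: connector_nonneg sums_iff)
      then show "(\<Sum>m. f n * g p * ennreal (if p < m then 1 / real m * connector n m else 0)) =
          f n * g p * ennreal (1 / real n * connector n p)"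
        by simp
    qed
    also have "\<dots> = (\<Sum>p. letter True f n * g p * ennreal (connector n p))"
      by (intro suminf_cong) (simp add: letter_def * mult_ac)
    finally show ?thesis .
  qed (use assms in simp)
  then show ?thesis by (simp add: pairing_def)
qed

lemma pairing_letter:
  assumes "f 0 = 0" "g 0 = 0"
  shows "pairing (letter b f) g = pairing f (letter (\<not> b) g)"
  using pairing_letter_True[of f g] pairing_letter_True[of g f] assms
  by (cases b) (auto simp: pairing_commute)

text \<open>The outermost letter on the left crosses first and so ends up innermost on the right,
  which reverses the word. Every letter preserves vanishing at 0.\<close>

lemma pairing_foldr_letter:
  assumes "f 0 = 0" "g 0 = 0"
  shows "pairing (foldr letter w f) g = pairing f (foldr letter (rev (map Not w)) g)"
  using assms(2)
proof (induction w arbitrary: g)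
  case (Cons b w)
  have "foldr letter w f 0 = 0"
    by (cases w) (use assms in auto)
  with Cons show ?case by (simp add: pairing_letter)
qed simp

text \<open>\<open>unit_mass\<close> does not vanish at 0, so the outer letters are treated
  separately: the last \<open>False\<close> turns \<open>unit_mass\<close> into \<open>?f\<close>,
  which vanishes at 0, and the first \<open>True\<close> crosses by
  \<open>pairing_letter_True\<close>, which restricts only its left argument.\<close>

lemma word_duality:
  "(\<Sum>n. foldr letter (True # w @ [False]) unit_mass n) =
   (\<Sum>n. foldr letter (rev (map Not (True # w @ [False]))) unit_mass n)"
proof -
  let ?f = "letter False unit_mass"
  have 0: "foldr letter w ?f 0 = 0" for w by (cases w) auto
  have "(\<Sum>n. foldr letter (True # w @ [False]) unit_mass n) = pairing (letter True (foldr letter w ?f)) unit_mass"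
    by (simp add: pairing_unit_mass)
  also have "\<dots> = pairing (foldr letter w ?f) ?f"
    by (intro pairing_letter_True 0)
  also have "\<dots> = pairing (foldr letter (rev (map Not w)) ?f) (letter False unit_mass)"
    by (subst pairing_foldr_letter) (auto simp: pairing_commute)
  also have "\<dots> = (\<Sum>n. letter True (foldr letter (rev (map Not w)) ?f) n)"
    by (subst pairing_letter_True[symmetric]) (auto simp: 0 pairing_unit_mass)
  finally show ?thesis by simp
qed

section \<open>Convergence and reduction to single sums\<close>

lemma inverse_power_le_powr:
  assumes "1 \<le> b" "b \<le> a"
  shows "(1 / real p) ^ a \<le> real p powr (- real b)"
proof (cases "p = 0")
  case False
  have "(1 / real p) ^ a \<le> (1 / real p) ^ b"
    using assms False by (intro power_decreasing) auto
  also have "\<dots> = real p powr (- real b)"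
    using False by (simp add: powr_minus powr_realpow power_divide inverse_eq_divide)
  finally show ?thesis .
qed (use assms in \<open>simp add: power_0_left\<close>)

lemma sum_lead_le_powr:
  assumes "\<forall>a\<in>set s. 1 \<le> a" "0 < e"
  shows "\<exists>C\<ge>0. \<forall>n. (\<Sum>p<n. lead s p) \<le> C * real n powr e"
  using assms
proof (induction s arbitrary: e)
  case Nil
  have "(\<Sum>p<n. lead [] p) \<le> 1 * real n powr e" for n
    using Nil by (cases n) (auto simp: ge_one_powr_ge_zero)
  then show ?case by (intro exI[of _ 1]) auto
next
  case (Cons a s)
  \<comment> \<open>Half of the exponent bounds the inner sum; the other half leaves the summable
    weight p^(-1-e/2).\<close>
  obtain C where C: "C \<ge> 0" "\<And>n. (\<Sum>p<n. lead s p) \<le> C * real n powr (e / 2)"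
    using Cons.IH[of "e / 2"] Cons.prems by auto
  let ?z = "\<lambda>p. real p powr (- 1 - e / 2)"
  have summable: "summable ?z"
    using Cons.prems by (subst summable_real_powr_iff) auto
  have "(\<Sum>p<n. lead (a # s) p) \<le> C * suminf ?z * real n powr e" for n
  proof -
    have "lead (a # s) p \<le> C * real n powr e * ?z p" if "p < n" for p
    proof -
      have "lead (a # s) p \<le> real p powr (- real 1) * (C * real p powr (e / 2))"
        unfolding lead.simps using Cons.prems C
        by (intro mult_mono inverse_power_le_powr sum_nonneg lead_nonneg) auto
      also have "real p powr (- real 1) * (C * real p powr (e / 2)) = C * (real p powr e * ?z p)"
        unfolding powr_add[symmetric] mult.left_commute[of _ C] by simp
      also have "\<dots> = C * real p powr e * ?z p" by simp
      also have "\<dots> \<le> C * real n powr e * ?z p"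
        using that C Cons.prems by (intro mult_right_mono mult_left_mono powr_mono2) auto
      finally show ?thesis .
    qed
    then have "(\<Sum>p<n. lead (a # s) p) \<le> (\<Sum>p<n. C * real n powr e * ?z p)"
      by (intro sum_mono) auto
    also have "\<dots> = C * real n powr e * (\<Sum>p<n. ?z p)"
      by (simp add: sum_distrib_left)
    also have "\<dots> \<le> C * real n powr e * suminf ?z"
      using C by (intro mult_left_mono sum_le_suminf summable) auto
    finally show ?thesis by (simp add: mult_ac)
  qed
  moreover have "0 \<le> C * suminf ?z"
    using C by (intro mult_nonneg_nonneg suminf_nonneg summable) auto
  ultimately show ?case by blast
qed

definition admissible :: "nat list \<Rightarrow> bool" where
  "admissible s \<longleftrightarrow> (\<forall>a\<in>set s. 1 \<le> a) \<and> (s \<noteq> [] \<longrightarrow> 2 \<le> hd s)"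

lemma summable_lead:
  assumes "admissible s"
  shows "summable (lead s)"
proof (cases s)
  case Nil
  then show ?thesis by (intro summable_finite[of "{0}"]) auto
next
  case (Cons a t)
  \<comment> \<open>Exponent 1/2 suffices: with a leading entry of at least 2, terms are bounded by
    a multiple of p^(-3/2).\<close>
  obtain C where C: "C \<ge> 0" "\<And>n. (\<Sum>p<n. lead t p) \<le> C * real n powr (1 / 2)"
    using sum_lead_le_powr[of t "1 / 2"] assms Cons by (auto simp: admissible_def)
  have "lead s p \<le> C * real p powr (- (3 / 2))" for p
  proof -
    have "lead s p \<le> real p powr (- real 2) * (C * real p powr (1 / 2))"
      unfolding lead.simps Cons using assms C Cons
      by (intro mult_mono inverse_power_le_powr sum_nonneg lead_nonneg) (auto simp: admissible_def)
    also have "\<dots> = C * real p powr (- (3 / 2))"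
      unfolding powr_add[symmetric] mult.left_commute[of _ C] by simp
    finally show ?thesis .
  qed
  moreover have "summable (\<lambda>p. C * real p powr (- (3 / 2)))"
    by (intro summable_mult) (subst summable_real_powr_iff, simp)
  ultimately show ?thesis
    by (intro summable_comparison_test[OF _ \<open>summable (\<lambda>p. C * real p powr (- (3 / 2)))\<close>])
      (auto simp: lead_nonneg)
qed

section \<open>Sums over strict chains as iterated single sums\<close>

lemma chain_term_Cons: "chain_term (a # s) (p # ns) = (1 / real p) ^ a * chain_term s ns"
  by (simp add: chain_term_def prod.lessThan_Suc_shift power_divide del: prod.lessThan_Suc)

lemma chain_term_nonneg: "0 \<le> chain_term s ns"
  by (auto simp: chain_term_def intro!: prod_nonneg)

definition strict_below :: "nat \<Rightarrow> nat \<Rightarrow> nat list set" where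
  "strict_below r n = {ns \<in> strict_chains r. \<forall>i\<in>set ns. i < n}"

lemma finite_strict_below: "finite (strict_below r n)"
  by (rule finite_subset[OF _ finite_lists_length_eq[of "{..<n}" r]])
    (auto simp: strict_below_def strict_chains_def)

lemma strict_chains_Suc:
  "bij_betw (\<lambda>(p, ns). p # ns) (SIGMA p:{0<..}. strict_below r p) (strict_chains (Suc r))"
  unfolding bij_betw_def
  by (auto simp: inj_on_def strict_below_def strict_chains_def length_Suc_conv image_iff Suc_le_eq)

lemma strict_below_Suc:
  "bij_betw (\<lambda>(p, ns). p # ns) (SIGMA p:{0<..<n}. strict_below r p) (strict_below (Suc r) n)"
  unfolding bij_betw_def
  by (auto simp: inj_on_def strict_below_def strict_chains_def length_Suc_conv image_iff Suc_le_eq)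
    (meson less_trans)

text \<open>At n = 0 this fails for the empty index: the empty chain still counts on the left, while
  \<open>lead []\<close> places it at p = 0.\<close>

lemma sum_strict_below:
  assumes "0 < n"
  shows "(\<Sum>ns\<in>strict_below (length s) n. chain_term s ns) = (\<Sum>p<n. lead s p)"
  using assms
proof (induction s arbitrary: n)
  case Nil
  have "strict_below 0 n = {[]}"
    by (auto simp: strict_below_def strict_chains_def)
  with Nil show ?case by (simp add: chain_term_def)
next
  case (Cons a s)
  have "(\<Sum>ns\<in>strict_below (length (a # s)) n. chain_term (a # s) ns) =
      (\<Sum>(p, ns)\<in>(SIGMA p:{0<..<n}. strict_below (length s) p). (1 / real p) ^ a * chain_term s ns)"
    unfolding list.size(4) add_Suc_right add_0_right
    by (subst sum.reindex_bij_betw[OF strict_below_Suc, symmetric])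
      (simp add: case_prod_unfold chain_term_Cons)
  also have "\<dots> = (\<Sum>p\<in>{0<..<n}. lead (a # s) p)"
    by (subst sum.Sigma[symmetric]) (auto simp: finite_strict_below Cons simp flip: sum_distrib_left)
  also have "\<dots> = (\<Sum>p<n. lead (a # s) p)"
    by (rule sum.mono_neutral_left) auto
  finally show ?case .
qed

lemma mzv_upto_eq: "mzv_upto n s = (\<Sum>p<Suc n. lead s p)"
proof -
  have "{ns \<in> strict_chains (length s). \<forall>i\<in>set ns. i \<le> n} = strict_below (length s) (Suc n)"
    by (auto simp: strict_below_def less_Suc_eq_le)
  then show ?thesis by (simp only: mzv_upto_def sum_strict_below[OF zero_less_Suc])
qed

lemma mzv_eq_suminf:
  assumes "admissible s"
  shows "mzv s = suminf (lead s)"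
proof (cases s)
  case Nil
  have "strict_chains 0 = {[]}"
    by (auto simp: strict_chains_def)
  moreover have "suminf (lead []) = 1"
    by (subst suminf_finite[of "{0}"]) auto
  ultimately show ?thesis using Nil by (simp add: mzv_def chain_term_def)
next
  case (Cons a t)
  let ?f = "\<lambda>(p, ns). (1 / real p) ^ a * chain_term t ns"
  have "(lead s has_sum suminf (lead s)) UNIV"
    using summable_lead[OF assms] by (intro sums_nonneg_imp_has_sum lead_nonneg) (simp add: summable_sums)
  then have sum: "(lead s has_sum suminf (lead s)) {0<..}"
    by (subst has_sum_cong_neutral[of UNIV _ _ "lead s"]) (auto simp: Cons)
  have inner: "((\<lambda>ns. ?f (p, ns)) has_sum lead s p) (strict_below (length t) p)" if "p \<in> {0<..}" for p
    using that sum_strict_below[of p t]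
    by (intro has_sum_finiteI) (auto simp: finite_strict_below Cons simp flip: sum_distrib_left)
  \<comment> \<open>Nonnegativity turns convergence of the iterated sum into summability over pairs
    (first entry, rest).\<close>
  have "?f summable_on (SIGMA p:{0<..}. strict_below (length t) p)"
    using inner has_sum_imp_summable[OF sum] by (rule summable_on_SigmaI) (auto simp: chain_term_nonneg)
  with inner sum have "(?f has_sum suminf (lead s)) (SIGMA p:{0<..}. strict_below (length t) p)"
    by (rule has_sum_SigmaI)
  also have "?f = (\<lambda>x. chain_term s (case x of (p, ns) \<Rightarrow> p # ns))"
    by (auto simp: Cons chain_term_Cons)
  finally have "(chain_term s has_sum suminf (lead s)) (strict_chains (length s))"
    unfolding has_sum_reindex_bij_betw[OF strict_chains_Suc] by (simp add: Cons)
  then show ?thesis by (simp add: mzv_def infsumI)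
qed

section \<open>Truncated star sums and the Kaneko-Yamamoto series\<close>

primrec star :: "nat list \<Rightarrow> nat \<Rightarrow> real" where
  "star [] n = 1"
| "star (a # s) n = (\<Sum>p\<le>n. (1 / real p) ^ a * star s p)"

definition weak_upto :: "nat \<Rightarrow> nat \<Rightarrow> nat list set" where
  "weak_upto r n = {ns \<in> weak_chains r. \<forall>i\<in>set ns. i \<le> n}"

lemma finite_weak_upto: "finite (weak_upto r n)"
  by (rule finite_subset[OF _ finite_lists_length_eq[of "{..n}" r]])
    (auto simp: weak_upto_def weak_chains_def)

lemma weak_upto_Suc:
  "bij_betw (\<lambda>(p, ns). p # ns) (SIGMA p:{0<..n}. weak_upto r p) (weak_upto (Suc r) n)"
  unfolding bij_betw_def
  by (auto simp: inj_on_def weak_upto_def weak_chains_def length_Suc_conv image_iff Suc_le_eq)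
    (meson order_trans)

text \<open>The term p = 0 in \<open>star\<close> is harmless, since (1/0)^a = 0 for positive
  a.\<close>

lemma mzsv_upto_eq:
  assumes "\<forall>a\<in>set s. 1 \<le> a"
  shows "mzsv_upto n s = star s n"
proof -
  have "(\<Sum>ns\<in>weak_upto (length s) n. chain_term s ns) = star s n"
    using assms
  proof (induction s arbitrary: n)
    case Nil
    have "weak_upto 0 n = {[]}"
      by (auto simp: weak_upto_def weak_chains_def)
    then show ?case by (simp add: chain_term_def)
  next
    case (Cons a s)
    have "(\<Sum>ns\<in>weak_upto (length (a # s)) n. chain_term (a # s) ns) =
        (\<Sum>(p, ns)\<in>(SIGMA p:{0<..n}. weak_upto (length s) p). (1 / real p) ^ a * chain_term s ns)"
      unfolding list.size(4) add_Suc_right add_0_right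
      by (subst sum.reindex_bij_betw[OF weak_upto_Suc, symmetric])
        (simp add: case_prod_unfold chain_term_Cons)
    also have "\<dots> = (\<Sum>p\<in>{0<..n}. (1 / real p) ^ a * star s p)"
      using Cons by (subst sum.Sigma[symmetric]) (auto simp: finite_weak_upto simp flip: sum_distrib_left)
    also have "\<dots> = star (a # s) n"
      unfolding star.simps using Cons.prems by (intro sum.mono_neutral_left) auto
    finally show ?case .
  qed
  then show ?thesis by (simp add: mzsv_upto_def weak_upto_def)
qed

lemma summable_mult_bounded:
  fixes f g :: "nat \<Rightarrow> real"
  assumes "summable f" "\<And>n. 0 \<le> f n" "\<And>n. 0 \<le> g n" "\<And>n. g n \<le> C"
  shows "summable (\<lambda>n. f n * g n)"
proof (rule summable_comparison_test)
  show "summable (\<lambda>n. f n * C)"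
    using assms by (intro summable_mult2)
qed (use assms in \<open>auto simp: abs_mult intro!: mult_left_mono\<close>)

lemma summable_inverse_power:
  assumes "2 \<le> a"
  shows "summable (\<lambda>p. (1 / real p) ^ a)"
  using inverse_power_summable[OF assms, where 'a = real] by (simp add: power_divide inverse_eq_divide)

lemma star_nonneg: "0 \<le> star s n"
  by (induction s arbitrary: n) (auto intro!: sum_nonneg)

lemma star_bounded:
  assumes "\<forall>a\<in>set s. 2 \<le> a"
  shows "\<exists>C. \<forall>n. star s n \<le> C"
  using assms
proof (induction s)
  case (Cons a s)
  then obtain C where C: "\<And>n. star s n \<le> C" by auto
  have "star (a # s) n \<le> (\<Sum>p. (1 / real p) ^ a * star s p)" for n
    unfolding star.simps using Cons.prems C
    by (intro sum_le_suminf summable_mult_bounded summable_inverse_power) (auto simp: star_nonneg)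
  then show ?case by blast
qed auto

lemma summable_star:
  assumes "\<forall>a\<in>set s. 2 \<le> a" "2 \<le> a"
  shows "summable (\<lambda>p. (1 / real p) ^ a * star s p)"
  using star_bounded[OF assms(1)] assms(2)
  by (auto intro!: summable_mult_bounded summable_inverse_power star_nonneg)

text \<open>The entry 0 adds nothing to the shared exponent, so for n >= 1 the strict factor divided
  by n^a is \<open>lead (a # ks) n\<close>; the added term n = 0 vanishes.\<close>

lemma kaneko_yamamoto_eq_suminf:
  assumes "admissible (a # ks)" "\<forall>b\<in>set ls. 2 \<le> b"
  shows "kaneko_yamamoto (a # ks) (0 # ls) = (\<Sum>n. lead (a # ks) n * star ls n)"
proof -
  obtain C where "\<And>n. star ls n \<le> C"
    using star_bounded[OF assms(2)] by auto
  then have "summable (\<lambda>n. lead (a # ks) n * star ls n)"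
    using summable_lead[OF assms(1)] by (intro summable_mult_bounded) (auto simp: lead_nonneg star_nonneg simp del: lead.simps)
  then have "((\<lambda>n. lead (a # ks) n * star ls n) has_sum (\<Sum>n. lead (a # ks) n * star ls n)) UNIV"
    by (intro sums_nonneg_imp_has_sum) (auto simp: lead_nonneg star_nonneg summable_sums simp del: lead.simps)
  also have "?this \<longleftrightarrow> ((\<lambda>n. mzv_upto (n - 1) ks * mzsv_upto n ls / real n ^ a)
      has_sum (\<Sum>n. lead (a # ks) n * star ls n)) {1..}"
  proof (rule has_sum_cong_neutral)
    fix n :: nat assume "n \<in> UNIV \<inter> {1..}"
    then show "lead (a # ks) n * star ls n = mzv_upto (n - 1) ks * mzsv_upto n ls / real n ^ a"
      using assms(2) by (subst mzsv_upto_eq) (force, auto simp: mzv_upto_eq power_divide simp del: sum.lessThan_Suc)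
  qed (auto simp: not_le)
  finally show ?thesis
    by (simp add: kaneko_yamamoto_def infsumI)
qed

section \<open>Expansion of truncated star sums\<close>

text \<open>Here the first entry belongs to the smallest variable, opposite to \<open>lead\<close>;
  this causes the reversals below.\<close>

primrec tail :: "nat list \<Rightarrow> nat \<Rightarrow> real" where
  "tail [] n = 1"
| "tail (a # s) n = (\<Sum>i. (1 / real (i + Suc n)) ^ a * tail s (i + Suc n))"

text \<open>Both claims share one induction because summability at the next level uses both.\<close>

lemma tail_bounds:
  assumes "\<forall>a\<in>set s. 2 \<le> a"
  shows "(\<forall>n. 0 \<le> tail s n) \<and> (\<exists>C. \<forall>n. tail s n \<le> C)"
  using assms
proof (induction s)
  case (Cons a s)
  then obtain C where C: "\<And>n. tail s n \<le> C" and nonneg: "\<And>n. 0 \<le> tail s n" by auto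
  let ?f = "\<lambda>p. (1 / real p) ^ a * tail s p"
  have f: "summable ?f" using Cons.prems C nonneg
    by (intro summable_mult_bounded summable_inverse_power) auto
  have "0 \<le> tail (a # s) n" for n
    unfolding tail.simps using nonneg f summable_ignore_initial_segment[OF f, of "Suc n"]
    by (intro suminf_nonneg) auto
  moreover have "tail (a # s) n \<le> suminf ?f" for n
    unfolding tail.simps suminf_minus_initial_segment[OF f, of "Suc n"]
    using sum_nonneg[of "{..<Suc n}" ?f] nonneg by (simp del: sum.lessThan_Suc)
  ultimately show ?case by blast
qed auto

lemma summable_tail:
  assumes "\<forall>a\<in>set s. 2 \<le> a" "2 \<le> a"
  shows "summable (\<lambda>p. (1 / real p) ^ a * tail s p)"
  using tail_bounds[OF assms(1)] assms(2)
  by (auto intro!: summable_mult_bounded summable_inverse_power)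

primrec star_inf :: "nat list \<Rightarrow> real" where
  "star_inf [] = 1"
| "star_inf (a # s) = (\<Sum>p. (1 / real p) ^ a * star s p)"

text \<open>The part p > n of the outermost sum is expanded by the induction hypothesis at p;
  summing over p prepends the entry a to each tail.\<close>

lemma star_eq_sum_tail:
  assumes "\<forall>a\<in>set s. 2 \<le> a"
  shows "star s n = (\<Sum>j\<le>length s. (- 1) ^ j * tail (take j s) n * star_inf (drop j s))"
  using assms
proof (induction s arbitrary: n)
  case (Cons a s)
  let ?c = "\<lambda>j. (- 1) ^ j * star_inf (drop j s)"
  have star: "summable (\<lambda>p. (1 / real p) ^ a * star s p)"
    using Cons.prems by (intro summable_star) auto
  have tail: "summable (\<lambda>i. (1 / real (i + Suc n)) ^ a * tail (take j s) (i + Suc n))" for j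
    using Cons.prems set_take_subset[of j s]
    by (intro summable_ignore_initial_segment[of "\<lambda>p. (1 / real p) ^ a * tail (take j s) p"] summable_tail) auto
  have "star_inf (a # s) - star (a # s) n = (\<Sum>i. (1 / real (i + Suc n)) ^ a * star s (i + Suc n))"
    using suminf_minus_initial_segment[OF star, of "Suc n"] by (simp add: lessThan_Suc_atMost del: sum.lessThan_Suc)
  also have "\<dots> = (\<Sum>i. \<Sum>j\<le>length s. ?c j * ((1 / real (i + Suc n)) ^ a * tail (take j s) (i + Suc n)))"
    using Cons by (simp add: sum_distrib_left mult_ac)
  also have "\<dots> = (\<Sum>j\<le>length s. ?c j * tail (a # take j s) n)"
    unfolding tail.simps by (subst suminf_sum) (intro summable_mult tail, simp only: suminf_mult[OF tail])
  finally have "star (a # s) n = star_inf (a # s) - (\<Sum>j\<le>length s. ?c j * tail (a # take j s) n)"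
    by simp
  \<comment> \<open>\<open>star_inf (a # s)\<close> is the term j = 0; the subtracted terms move to
    j + 1 and supply the extra sign.\<close>
  also have "\<dots> = (\<Sum>j\<le>length (a # s). (- 1) ^ j * tail (take j (a # s)) n * star_inf (drop j (a # s)))"
    by (simp add: sum.atMost_Suc_shift sum_negf mult_ac del: sum.atMost_Suc star_inf.simps tail.simps(2))
  finally show ?case .
qed simp

text \<open>Both iterated sums run over the pairs n < p, and nonnegativity permits the
  exchange.\<close>

lemma sums_triangle_swap:
  fixes a b :: "nat \<Rightarrow> real"
  assumes "\<And>n. 0 \<le> a n" "\<And>n. 0 \<le> b n" "summable b" "(\<lambda>p. b p * (\<Sum>n<p. a n)) sums L"
  shows "(\<lambda>n. a n * (\<Sum>i. b (i + Suc n))) sums L"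
proof -
  let ?f = "\<lambda>(p, n). b p * a n"
  have L: "((\<lambda>p. b p * (\<Sum>n<p. a n)) has_sum L) UNIV"
    using assms by (intro sums_nonneg_imp_has_sum) (auto intro!: mult_nonneg_nonneg sum_nonneg)
  have inner: "((\<lambda>n. ?f (p, n)) has_sum b p * (\<Sum>n<p. a n)) {..<p}" for p
    by (intro has_sum_finiteI) (auto simp: sum_distrib_left)
  have "?f summable_on (SIGMA p:UNIV. {..<p})"
    using inner has_sum_imp_summable[OF L] by (rule summable_on_SigmaI) (use assms in auto)
  with inner L have "(?f has_sum L) (SIGMA p:UNIV. {..<p})"
    by (rule has_sum_SigmaI)
  also have "?this \<longleftrightarrow> ((\<lambda>(n, p). a n * b p) has_sum L) (SIGMA n:UNIV. {n<..})"
    by (rule has_sum_reindex_bij_witness[of _ prod.swap prod.swap]) auto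
  finally have "((\<lambda>n. a n * (\<Sum>i. b (i + Suc n))) has_sum L) UNIV"
  proof (rule has_sum_SigmaD)
    fix n
    have "((\<lambda>i. b (i + Suc n)) has_sum (\<Sum>i. b (i + Suc n))) UNIV"
      using assms summable_ignore_initial_segment[OF assms(3), of "Suc n"]
      by (intro sums_nonneg_imp_has_sum) (auto simp: summable_sums)
    also have "?this \<longleftrightarrow> (b has_sum (\<Sum>i. b (i + Suc n))) {n<..}"
      by (rule has_sum_reindex_bij_witness[of _ "\<lambda>p. p - Suc n" "\<lambda>i. i + Suc n"]) auto
    finally show "((\<lambda>p. case (n, p) of (n, p) \<Rightarrow> a n * b p) has_sum a n * (\<Sum>i. b (i + Suc n))) {n<..}"
      by (auto intro: has_sum_cmult_right)
  qed
  then show ?thesis by (rule has_sum_imp_sums)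
qed

text \<open>Exchanging the sums moves the smallest variable of the tail on top of the chain of s, so
  the entries of t pass to s one by one.\<close>

lemma lead_mult_tail_sums:
  assumes "admissible s" "\<forall>a\<in>set t. 2 \<le> a"
  shows "(\<lambda>n. lead s n * tail t n) sums mzv (rev t @ s)"
  using assms
proof (induction t arbitrary: s)
  case Nil
  then show ?case by (simp add: mzv_eq_suminf summable_lead summable_sums)
next
  case (Cons a t)
  have "admissible (a # s)"
    using Cons.prems by (auto simp: admissible_def)
  then have "(\<lambda>p. lead (a # s) p * tail t p) sums mzv (rev (a # t) @ s)"
    using Cons.IH[of "a # s"] Cons.prems by simp
  then have "(\<lambda>p. (1 / real p) ^ a * tail t p * (\<Sum>n<p. lead s n)) sums mzv (rev (a # t) @ s)"
    by (simp add: mult_ac)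
  then show ?case
    unfolding tail.simps using Cons.prems tail_bounds[of t]
    by (intro sums_triangle_swap summable_tail lead_nonneg) auto
qed

lemma tail_0_eq_mzv:
  assumes "\<forall>a\<in>set t. 2 \<le> a"
  shows "tail t 0 = mzv (rev t)"
proof -
  have "(\<lambda>n. lead [] n * tail t n) sums mzv (rev t @ [])"
    using assms by (intro lead_mult_tail_sums) (auto simp: admissible_def)
  moreover have "(\<lambda>n. lead [] n * tail t n) sums (\<Sum>n\<in>{0}. lead [] n * tail t n)"
    by (rule sums_finite) auto
  ultimately show ?thesis using sums_unique2 by fastforce
qed

lemma kaneko_yamamoto_eq_sum:
  assumes "admissible (a # ks)" "\<forall>b\<in>set ls. 2 \<le> b"
  shows "kaneko_yamamoto (a # ks) (0 # ls) =
    (\<Sum>j\<le>length ls. (- 1) ^ j * mzv (rev (take j ls) @ a # ks) * star_inf (drop j ls))"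
proof -
  have "(\<lambda>n. lead (a # ks) n * tail (take j ls) n) sums mzv (rev (take j ls) @ a # ks)" for j
    using assms set_take_subset[of j ls] by (intro lead_mult_tail_sums) auto
  then have "(\<lambda>n. \<Sum>j\<le>length ls. (- 1) ^ j * (lead (a # ks) n * tail (take j ls) n) * star_inf (drop j ls)) sums
    (\<Sum>j\<le>length ls. (- 1) ^ j * mzv (rev (take j ls) @ a # ks) * star_inf (drop j ls))"
    by (intro sums_sum sums_mult sums_mult2)
  moreover have "(\<Sum>j\<le>length ls. (- 1) ^ j * (lead (a # ks) n * tail (take j ls) n) * star_inf (drop j ls)) =
      lead (a # ks) n * star ls n" for n
    by (simp add: star_eq_sum_tail[OF assms(2)] sum_distrib_left mult_ac)
  ultimately show ?thesis
    using kaneko_yamamoto_eq_suminf[OF assms] by (simp add: sums_iff)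
qed

text \<open>This is \<open>star_eq_sum_tail\<close> at n = 0, where the left side vanishes, solved
  for its term j = 0.\<close>

lemma star_inf_Cons:
  assumes "\<forall>b\<in>set (a # s). 2 \<le> b"
  shows "star_inf (a # s) = (\<Sum>j\<le>length s. (- 1) ^ j * mzv (rev (a # take j s)) * star_inf (drop j s))"
proof -
  have "tail (a # take j s) 0 = mzv (rev (a # take j s))" for j
    using assms set_take_subset[of j s] by (intro tail_0_eq_mzv) auto
  moreover have "star (a # s) 0 = 0"
    using assms by simp
  ultimately show ?thesis
    using star_eq_sum_tail[OF assms, of 0]
    by (simp add: sum.atMost_Suc_shift sum_negf mult_ac del: sum.atMost_Suc star_inf.simps tail.simps(2) star.simps(2))
qed

section \<open>Dual indices\<close>

lemma admissible_word:
  assumes "admissible s" "s \<noteq> []"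
  obtains w where "word s = True # w @ [False]"
proof -
  obtain a t where s: "s = a # t" "2 \<le> a"
    using assms by (cases s) (auto simp: admissible_def)
  obtain v where v: "False # word t = v @ [False]"
  proof (cases t rule: rev_cases)
    case Nil
    then show ?thesis using that[of "[]"] by simp
  next
    case (snoc ys y)
    then show ?thesis using that[of "False # word ys @ replicate (y - 1) True"] by (simp add: word_Cons)
  qed
  obtain b where "a = Suc (Suc b)"
    using s by (metis add_2_eq_Suc le_Suc_ex)
  then have "word s = True # (replicate b True @ v) @ [False]"
    by (simp add: s word_Cons v)
  then show ?thesis using that by blast
qed

lemma ennreal_mzv:
  assumes "admissible s"
  shows "ennreal (mzv s) = (\<Sum>n. foldr letter (word s) unit_mass n)"
  using assms
  by (simp add: mzv_eq_suminf foldr_letter_word admissible_def suminf_ennreal2 lead_nonneg summable_lead)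

lemma mzv_nonneg: "admissible s \<Longrightarrow> 0 \<le> mzv s"
  by (simp add: mzv_eq_suminf suminf_nonneg lead_nonneg summable_lead)

theorem mzv_duality:
  assumes "admissible s" "admissible t" "s \<noteq> []" "word t = rev (map Not (word s))"
  shows "mzv s = mzv t"
proof -
  obtain w where w: "word s = True # w @ [False]"
    using admissible_word assms by blast
  have "ennreal (mzv s) = ennreal (mzv t)"
    unfolding ennreal_mzv[OF assms(1)] ennreal_mzv[OF assms(2)] assms(4) w by (rule word_duality)
  then show ?thesis by (simp add: mzv_nonneg assms)
qed

text \<open>The reversed and letter-swapped block of the entry q + 1.\<close>

definition dual_block :: "nat \<Rightarrow> bool list" where
  "dual_block q = True # replicate q False"

lemma rev_Not_word:
  "rev (map Not (word (map (\<lambda>i. f i + 1) l))) = concat (map (\<lambda>i. dual_block (f i)) (rev l))"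
  by (induction l) (auto simp: word_Cons dual_block_def)

text \<open>The final entry stays open as \<open>[True, False]\<close>. For q = 0 merging adds one
  \<open>True\<close>; for q >= 1 the final \<open>False\<close> and the q - 1 ones complete the
  block, and the new 2 opens the next.\<close>

lemma word_box:
  assumes "us \<noteq> []" "\<forall>a\<in>set us. 1 \<le> a" "word us = x @ [True, False]"
  shows "word (box us q 2) = x @ dual_block q @ [True, False]"
proof (cases "q = 0")
  case True
  obtain vs u where us: "us = vs @ [Suc u]"
    using assms by (cases us rule: rev_cases) (auto simp: Suc_le_eq gr0_conv_Suc)
  with assms have "word vs @ replicate u True = x @ [True]"
    by (simp add: word_Cons)
  with us True show ?thesis
    by (simp add: box_def word_Cons dual_block_def replicate_append_same[symmetric] flip: append_assoc)
next
  case False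
  with assms show ?thesis
    by (cases q) (auto simp: box_def word_Cons dual_block_def)
qed

lemma admissible_box:
  assumes "admissible us" "us \<noteq> []"
  shows "admissible (box us q 2) \<and> box us q 2 \<noteq> []"
  using assms by (cases us rule: rev_cases; cases "butlast us") (auto simp: admissible_def box_def)

lemma k_dual_props:
  assumes "1 \<le> r" "1 \<le> \<kappa> r"
  shows "admissible (k_dual \<kappa> r)" "k_dual \<kappa> r \<noteq> []"
    "word (k_dual \<kappa> r) = concat (map (\<lambda>i. dual_block (\<kappa> i)) [1..<r + 1])"
proof -
  define us where "us r = foldl (\<lambda>us i. box us (\<kappa> i) 2) [2] [1..<r]" for r
  \<comment> \<open>Invariant: finished blocks followed by the open entry 2. The final ones of
    \<open>k_dual\<close> close it to \<open>dual_block (\<kappa> r)\<close>, which needs \<kappa> r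
    \<ge> 1.\<close>
  have us: "admissible (us r) \<and> us r \<noteq> [] \<and>
      word (us r) = concat (map (\<lambda>i. dual_block (\<kappa> i)) [1..<r]) @ [True, False]"
    using assms(1)
  proof (induction r rule: dec_induct)
    case base
    show ?case by (simp add: us_def admissible_def word_Cons numeral_2_eq_2)
  next
    case (step r)
    have "us (Suc r) = box (us r) (\<kappa> r) 2"
      using step by (simp add: us_def)
    then show ?case
      using step admissible_box[of "us r" "\<kappa> r"] word_box[of "us r" _ "\<kappa> r"]
      by (auto simp: admissible_def)
  qed
  have k: "k_dual \<kappa> r = us r @ replicate (\<kappa> r - 1) 1"
    by (simp add: k_dual_def us_def)
  show "admissible (k_dual \<kappa> r)" "k_dual \<kappa> r \<noteq> []"
    using us by (auto simp: k admissible_def)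
  show "word (k_dual \<kappa> r) = concat (map (\<lambda>i. dual_block (\<kappa> i)) [1..<r + 1])"
    using us assms by (cases "\<kappa> r") (auto simp: k dual_block_def)
qed

lemma word_m_dual:
  assumes "\<And>i. i \<in> {1..q} \<Longrightarrow> 1 \<le> m i"
  shows "word (m_dual m q) = concat (map (\<lambda>i. dual_block (m i)) [1..<q + 1])"
  using assms
proof (induction q)
  case (Suc q)
  have "1 \<le> m (Suc q)" using Suc.prems by simp
  moreover have "m_dual m (Suc q) = m_dual m q @ 2 # replicate (m (Suc q) - 1) 1"
    by (simp add: m_dual_def)
  ultimately show ?case
    using Suc by (cases "m (Suc q)") (auto simp: word_Cons dual_block_def numeral_2_eq_2)
qed (simp add: m_dual_def)

text \<open>Reversal puts the \<kappa> blocks first and makes both groups increasing, which is the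
  word of the right-hand index.\<close>

lemma mzv_dual_index:
  assumes "1 \<le> r" "1 \<le> \<kappa> r" "\<And>i. i \<in> {1..q} \<Longrightarrow> 1 \<le> m i"
  shows "mzv (rev (map (\<lambda>i. m i + 1) [1..<q + 1]) @ map (\<lambda>i. \<kappa> i + 1) (rev [1..<r + 1])) =
    mzv (k_dual \<kappa> r @ m_dual m q)"
proof (rule mzv_duality)
  let ?s = "rev (map (\<lambda>i. m i + 1) [1..<q + 1]) @ map (\<lambda>i. \<kappa> i + 1) (rev [1..<r + 1])"
  note k = k_dual_props[of r \<kappa>, OF assms(1,2)]
  show "admissible ?s"
    using assms by (cases q) (auto simp: admissible_def)
  show "?s \<noteq> []" using assms by simp
  show "admissible (k_dual \<kappa> r @ m_dual m q)"
    using k by (auto simp: admissible_def m_dual_def)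
  show "word (k_dual \<kappa> r @ m_dual m q) = rev (map Not (word ?s))"
    by (simp only: rev_map[of "\<lambda>i. m i + 1"] word_append map_append rev_append rev_Not_word k
        word_m_dual[OF assms(3)] rev_rev_ident)
qed

section \<open>Signed path sums\<close>

definition paths :: "nat \<Rightarrow> nat \<Rightarrow> nat \<Rightarrow> nat list set" where
  "paths K l j = {i. length i = l + 1 \<and> sorted_wrt (<) i \<and> i ! 0 = j \<and> i ! l = K}"

lemma paths_0: "paths K 0 j = (if j = K then {[K]} else {})"
  by (auto simp: paths_def length_Suc_conv)

lemma nth_0_path: "p \<in> paths K l j \<Longrightarrow> p ! 0 = j"
  by (simp add: paths_def)

lemma paths_Suc: "bij_betw (\<lambda>(i, p). j # p) (SIGMA i:{j<..K}. paths K l i) (paths K (Suc l) j)"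
  unfolding bij_betw_def
proof
  show "inj_on (\<lambda>(i, p). j # p) (SIGMA i:{j<..K}. paths K l i)"
    by (auto simp: inj_on_def paths_def)
  show "(\<lambda>(i, p). j # p) ` (SIGMA i:{j<..K}. paths K l i) = paths K (Suc l) j" (is "?A = ?B")
  proof
    show "?A \<subseteq> ?B"
    proof clarsimp
      fix i p assume "j < i" "p \<in> paths K l i"
      then show "j # p \<in> paths K (Suc l) j"
        by (cases p) (auto simp: paths_def intro: less_trans)
    qed
    show "?B \<subseteq> ?A"
    proof
      fix x assume x: "x \<in> ?B"
      then obtain i p where ip: "x = j # i # p"
        by (auto simp: paths_def length_Suc_conv)
      with x have "j < i" "i # p \<in> paths K l i"
        by (auto simp: paths_def)
      moreover from this have "i \<le> K"
        by (cases l) (auto simp: paths_def less_imp_le)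
      ultimately show "x \<in> ?A" by (auto simp: ip image_iff)
    qed
  qed
qed

lemma finite_paths: "finite (paths K l j)"
proof (induction l arbitrary: j)
  case (Suc l)
  then have "finite (SIGMA i:{j<..K}. paths K l i)" by auto
  then show ?case using bij_betw_finite[OF paths_Suc] by blast
qed (simp add: paths_0)

definition path_sum :: "(nat \<Rightarrow> nat \<Rightarrow> real) \<Rightarrow> nat \<Rightarrow> nat \<Rightarrow> nat \<Rightarrow> real" where
  "path_sum z K l j = (\<Sum>i\<in>paths K l j. \<Prod>h = 1..l. z (i ! (h - 1)) (i ! h))"

lemma path_sum_0: "path_sum z K 0 j = (if j = K then 1 else 0)"
  by (simp add: path_sum_def paths_0)

lemma path_sum_Suc: "path_sum z K (Suc l) j = (\<Sum>i\<in>{j<..K}. z j i * path_sum z K l i)"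
proof -
  have "path_sum z K (Suc l) j =
      (\<Sum>(i, p)\<in>(SIGMA i:{j<..K}. paths K l i). \<Prod>h<Suc l. z ((j # p) ! h) (p ! h))"
    unfolding path_sum_def
    by (subst sum.reindex_bij_betw[OF paths_Suc, symmetric])
      (simp add: case_prod_unfold prod.atLeast1_atMost_eq)
  also have "\<dots> = (\<Sum>i\<in>{j<..K}. \<Sum>p\<in>paths K l i. z j i * (\<Prod>h<l. z (p ! h) (p ! Suc h)))"
    by (subst sum.Sigma[symmetric])
      (auto simp: finite_paths prod.lessThan_Suc_shift nth_0_path simp del: prod.lessThan_Suc intro!: sum.cong)
  finally show ?thesis
    by (simp add: path_sum_def sum_distrib_left prod.atLeast1_atMost_eq)
qed

text \<open>Each step raises the vertex by at least one, so no path has more than K - j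
  steps.\<close>

lemma path_sum_eq_0: "K - j < l \<Longrightarrow> path_sum z K l j = 0"
proof (induction l arbitrary: j)
  case (Suc l)
  have "path_sum z K l i = 0" if "i \<in> {j<..K}" for i
    using that Suc.prems by (intro Suc.IH) auto
  then show ?case by (simp add: path_sum_Suc)
qed simp

definition signed_path_sum :: "(nat \<Rightarrow> nat \<Rightarrow> real) \<Rightarrow> nat \<Rightarrow> nat \<Rightarrow> real" where
  "signed_path_sum z K j = (if j = K then 1 else \<Sum>l = 1..K - j. (- 1) ^ l * path_sum z K l j)"

text \<open>The term l = 0 absorbs the convention at j = K and overlong paths contribute 0. A range
  independent of j permits exchanging sums in the recursion.\<close>

lemma signed_path_sum_alt:
  assumes "K \<le> N"
  shows "signed_path_sum z K j = (\<Sum>l\<le>N. (- 1) ^ l * path_sum z K l j)"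
proof (cases "j = K")
  case True
  have "(\<Sum>l\<le>N. (- 1) ^ l * path_sum z K l j) = (\<Sum>l\<in>{0}. (- 1) ^ l * path_sum z K l j)"
    using True by (intro sum.mono_neutral_right) (auto simp: path_sum_eq_0)
  then show ?thesis using True by (simp add: signed_path_sum_def path_sum_0)
next
  case False
  have "(\<Sum>l = 1..K - j. (- 1) ^ l * path_sum z K l j) = (\<Sum>l\<le>N. (- 1) ^ l * path_sum z K l j)"
    using False assms
    by (intro sum.mono_neutral_left)
      (auto simp: path_sum_0 path_sum_eq_0 not_le Suc_le_eq)
  then show ?thesis using False by (simp add: signed_path_sum_def)
qed

text \<open>The first step j to i is split off; losing one step flips the sign.\<close>

lemma signed_path_sum_rec:
  assumes "j \<noteq> K"
  shows "signed_path_sum z K j = - (\<Sum>i\<in>{j<..K}. z j i * signed_path_sum z K i)"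
proof -
  have "signed_path_sum z K j = (\<Sum>l\<le>K. (- 1) ^ Suc l * path_sum z K (Suc l) j)"
    using assms signed_path_sum_alt[of K "Suc K" z j]
    by (simp add: sum.atMost_Suc_shift path_sum_0 del: sum.atMost_Suc)
  also have "\<dots> = - (\<Sum>l\<le>K. \<Sum>i\<in>{j<..K}. z j i * ((- 1) ^ l * path_sum z K l i))"
    by (simp add: path_sum_Suc sum_negf sum_distrib_left mult_ac)
  also have "\<dots> = - (\<Sum>i\<in>{j<..K}. z j i * signed_path_sum z K i)"
    by (subst sum.swap) (simp add: signed_path_sum_alt[of K K] sum_distrib_left)
  finally show ?thesis .
qed

text \<open>Up to the sign (-1)^(K-j), \<open>star_inf_Cons\<close> is the recursion
  \<open>signed_path_sum_rec\<close>, with i the first index not consumed by the zeta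
  factor.\<close>

lemma star_inf_eq_signed_path_sum:
  fixes f :: "nat \<Rightarrow> nat"
  assumes "j \<le> K" "\<And>i. i \<in> {j..<K} \<Longrightarrow> 2 \<le> f i"
  shows "star_inf (map f [j..<K]) =
    (- 1) ^ (K - j) * signed_path_sum (\<lambda>i i'. mzv (map f (rev [i..<i']))) K j"
  using assms
proof (induction "K - j" arbitrary: j rule: less_induct)
  case less
  let ?z = "\<lambda>i i'. mzv (map f (rev [i..<i']))"
  show ?case
  proof (cases "j = K")
    case True
    then show ?thesis by (simp add: signed_path_sum_def)
  next
    case False
    with less.prems have j: "j < K" by simp
    have "star_inf (map f [j..<K]) = star_inf (f j # map f [Suc j..<K])"
      using j by (simp add: upt_conv_Cons)
    also have "\<dots> = (\<Sum>t\<le>K - Suc j. (- 1) ^ t * mzv (rev (f j # take t (map f [Suc j..<K]))) *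
        star_inf (drop t (map f [Suc j..<K])))"
      using j less.prems by (subst star_inf_Cons) auto
    also have "\<dots> = (\<Sum>i\<in>{j<..K}. (- 1) ^ (i - Suc j) * ?z j i * star_inf (map f [i..<K]))"
    proof (rule sum.reindex_bij_witness[of _ "\<lambda>i. i - Suc j" "\<lambda>t. t + Suc j"])
      fix t assume "t \<in> {..K - Suc j}"
      with j have t: "t + Suc j \<le> K" by simp
      then have "f j # take t (map f [Suc j..<K]) = map f [j..<t + Suc j]"
        by (simp add: take_map take_upt upt_conv_Cons add.commute del: upt_Suc)
      moreover have "drop t (map f [Suc j..<K]) = map f [t + Suc j..<K]"
        by (simp add: drop_map drop_upt add.commute)
      ultimately show "(- 1) ^ (t + Suc j - Suc j) * ?z j (t + Suc j) * star_inf (map f [t + Suc j..<K]) =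
          (- 1) ^ t * mzv (rev (f j # take t (map f [Suc j..<K]))) * star_inf (drop t (map f [Suc j..<K]))"
        by (simp only: rev_map add_diff_cancel_right')
    qed (use j in auto)
    also have "\<dots> = (\<Sum>i\<in>{j<..K}. (- 1) ^ (K - Suc j) * (?z j i * signed_path_sum ?z K i))"
    proof (rule sum.cong)
      fix i assume i: "i \<in> {j<..K}"
      then have "star_inf (map f [i..<K]) = (- 1) ^ (K - i) * signed_path_sum ?z K i"
        using less.prems by (intro less.hyps) auto
      moreover have "(- 1 :: real) ^ (K - Suc j) = (- 1) ^ (i - Suc j) * (- 1) ^ (K - i)"
        using i by (subst power_add[symmetric]) auto
      ultimately show "(- 1) ^ (i - Suc j) * ?z j i * star_inf (map f [i..<K]) =
          (- 1) ^ (K - Suc j) * (?z j i * signed_path_sum ?z K i)"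
        by simp
    qed simp
    also have "\<dots> = (- 1) ^ (K - Suc j) * - signed_path_sum ?z K j"
      unfolding signed_path_sum_rec[OF False] by (simp add: sum_distrib_left)
    also have "\<dots> = (- 1) ^ (K - j) * signed_path_sum ?z K j"
      using j by (simp add: Suc_diff_Suc[symmetric])
    finally show ?thesis .
  qed
qed

theorem theorem5p5:
  fixes k r :: nat and m \<kappa> :: "nat \<Rightarrow> nat"
  assumes "k \<ge> 1" and "r \<ge> 1"
    and "\<And>i. i \<in> {1..k} \<Longrightarrow> m i \<ge> 1"
    and "\<kappa> r \<ge> 1"
  shows "kaneko_yamamoto (map (\<lambda>i. \<kappa> i + 1) (rev [1..<r + 1]))
                         (0 # map (\<lambda>i. m i + 1) [1..<k + 1]) =
    (-1) ^ k * (\<Sum>j = 1..k + 1. mzv (k_dual \<kappa> r @ m_dual m (j - 1)) *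
      (if j = k + 1 then 1
       else \<Sum>l = 1..k + 1 - j. (-1) ^ l *
         (\<Sum>i\<in>{i. length i = l + 1 \<and> sorted_wrt (<) i \<and> i ! 0 = j \<and> i ! l = k + 1}.
            \<Prod>h = 1..l. mzv (map (\<lambda>t. m t + 1) (rev [i ! (h - 1)..<i ! h])))))"
proof -
  let ?f = "\<lambda>i. m i + 1"
  let ?ks = "map (\<lambda>i. \<kappa> i + 1) (rev [1..<r + 1])"
  let ?ls = "map ?f [1..<k + 1]"
  let ?D = "signed_path_sum (\<lambda>i i'. mzv (map ?f (rev [i..<i']))) (k + 1)"
  have ks: "?ks = (\<kappa> r + 1) # map (\<lambda>i. \<kappa> i + 1) (rev [1..<r])"
    using assms by simp
  have "kaneko_yamamoto ?ks (0 # ?ls) =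
      (\<Sum>j\<le>length ?ls. (- 1) ^ j * mzv (rev (take j ?ls) @ ?ks) * star_inf (drop j ?ls))"
    unfolding ks using assms(3,4) by (intro kaneko_yamamoto_eq_sum) (force simp: admissible_def)+
  also have "\<dots> = (\<Sum>j\<le>k. (- 1) ^ k * (mzv (k_dual \<kappa> r @ m_dual m j) * ?D (Suc j)))"
  proof (rule sum.cong)
    fix j assume "j \<in> {..k}"
    then have j: "j \<le> k" by simp
    have "mzv (rev (take j ?ls) @ ?ks) = mzv (rev (map ?f [1..<j + 1]) @ ?ks)"
      using j by (simp add: take_map take_upt del: upt_Suc)
    also have "\<dots> = mzv (k_dual \<kappa> r @ m_dual m j)"
      using assms j by (intro mzv_dual_index) auto
    finally have 1: "mzv (rev (take j ?ls) @ ?ks) = mzv (k_dual \<kappa> r @ m_dual m j)" .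
    have "star_inf (drop j ?ls) = star_inf (map ?f [Suc j..<k + 1])"
      by (simp add: drop_map drop_upt del: upt_Suc)
    also have "\<dots> = (- 1) ^ (k + 1 - Suc j) * ?D (Suc j)"
      using assms(3) j by (intro star_inf_eq_signed_path_sum) force+
    finally have 2: "star_inf (drop j ?ls) = (- 1) ^ (k - j) * ?D (Suc j)" by simp
    have 3: "(- 1 :: real) ^ k = (- 1) ^ j * (- 1) ^ (k - j)"
      using j by (subst power_add[symmetric]) auto
    show "(- 1) ^ j * mzv (rev (take j ?ls) @ ?ks) * star_inf (drop j ?ls) =
        (- 1) ^ k * (mzv (k_dual \<kappa> r @ m_dual m j) * ?D (Suc j))"
      unfolding 1 2 3 by simp
  qed simp
  also have "\<dots> = (- 1) ^ k * (\<Sum>j\<le>k. mzv (k_dual \<kappa> r @ m_dual m j) * ?D (Suc j))"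
    by (simp add: sum_distrib_left)
  also have "(\<Sum>j\<le>k. mzv (k_dual \<kappa> r @ m_dual m j) * ?D (Suc j)) =
      (\<Sum>j = 1..k + 1. mzv (k_dual \<kappa> r @ m_dual m (j - 1)) * ?D j)"
    by (rule sum.reindex_bij_witness[of _ "\<lambda>j. j - 1" Suc]) auto
  finally show ?thesis
    unfolding signed_path_sum_def path_sum_def paths_def .
qed

end
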